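(* Let $\Gamma$ be a groupoid and let $R$ be a right $\Gamma_0$-artinian $\Gamma$-graded ring. The following statements hold: (1) $\mathrm{rad}^{\mathrm{gr}}(R)$ is the greatest $\Gamma_0$-nilpotent graded ideal (respectively, the greatest $\Gamma_0$-nilpotent graded right ideal, the greatest $\Gamma_0$-nilpotent graded left ideal) of $R$. (2) $\mathrm{rad}^{\mathrm{gr}}(R)$ is the greatest gr-nil graded ideal (respectively, right ideal, left ideal) of $R$. (3) If $U$ is a graded ideal (respectively, right ideal, left ideal) of $R$ such that $U_e$ is a nil ideal (respectively, right ideal, left ideal) of $R_e$ for every $e\in\Gamma_0$, then $U$ is $\Gamma_0$-nilpotent. (4) Every gr-nil graded ideal (respectively, right ideal, left ideal) of $R$ is $\Gamma_0$-nilpotent.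
   Context: A groupoid $\Gamma$ is the set of morphisms of a small category in which all morphisms are invertible; $\Gamma_0\subseteq\Gamma$ is the set of identity morphisms; $d(\gamma)=\gamma^{-1}\gamma$, $r(\gamma)=\gamma\gamma^{-1}$; the product $\gamma\delta$ is defined iff $d(\gamma)=r(\delta)$. Rings are associative, not necessarily unital. A $\Gamma$-graded ring is a ring $R=\bigoplus_{\gamma\in\Gamma}R_\gamma$ (additive subgroups) with $R_\gamma R_\delta\subseteq R_{\gamma\delta}$ if $d(\gamma)=r(\delta)$ and $R_\gamma R_\delta=0$ otherwise; it is always assumed object unital: for each $e\in\Gamma_0$ the ring $R_e$ has an identity $1_e$ (possibly $0$) with $1_{r(\gamma)}a=a=a1_{d(\gamma)}$ for all $a\in R_\gamma$, $\gamma\in\Gamma$. Homogeneous elements are the elements of $\bigcup_\gamma R_\gamma$. One- or two-sided ideals $U$ are graded if $U=\bigoplus_\gamma U_\gamma$, where $U_\gamma=U\cap R_\gamma$. $R$ is right $\Gamma_0$-artinian if for every $e\in\Gamma_0$ there is no infinite strictly decreasing chain of graded right ideals of $R$ contained in $1_eR$. $\mathrm{rad}^{\mathrm{gr}}(R)$ is the intersection of all gr-maximal graded right ideals (those maximal among proper graded right ideals); it is a graded two-sided ideal. A graded one- or two-sided ideal $U$ is gr-nil if every homogeneous element of $U$ is nilpotent; it is $\Gamma_0$-nilpotent if for each $e\in\Gamma_0$ there is a positive integer $n_e$ with $(1_eU)^{n_e}=0$ (equivalently, for each $e$ there is $m_e$ with $(U1_e)^{m_e}=0$; equivalently, each $1_eU1_e$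 is nilpotent). *)

theory Defs
  imports Main "HOL-Computational_Algebra.Group_Closure"
begin

section \<open>Groupoids\<close>

text \<open>A small category is presented by its set of morphisms \<open>mor\<close>; objects are identified with
  identity morphisms, so domain and range of a morphism are again morphisms.  The product
  \<open>gmult \<Gamma> \<gamma> \<delta>\<close> is meaningful only if \<open>gdom \<Gamma> \<gamma> = gran \<Gamma> \<delta>\<close>, and all field values
  outside \<open>mor\<close> are irrelevant.  The set of morphisms may be empty.\<close>

record 'g groupoid_struct =
  mor :: "'g set"
  gdom :: "'g \<Rightarrow> 'g"
  gran :: "'g \<Rightarrow> 'g"
  gmult :: "'g \<Rightarrow> 'g \<Rightarrow> 'g"
  ginv :: "'g \<Rightarrow> 'g"

definition objs :: "'g groupoid_struct \<Rightarrow> 'g set" where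
  "objs \<Gamma> = {e \<in> mor \<Gamma>. gdom \<Gamma> e = e \<and> gran \<Gamma> e = e}"

locale groupoid =
  fixes \<Gamma> :: "'g groupoid_struct"
  assumes gdom_objs: "\<gamma> \<in> mor \<Gamma> \<Longrightarrow> gdom \<Gamma> \<gamma> \<in> objs \<Gamma>"
    and gran_objs: "\<gamma> \<in> mor \<Gamma> \<Longrightarrow> gran \<Gamma> \<gamma> \<in> objs \<Gamma>"
    and gmult_closed: "\<lbrakk>\<gamma> \<in> mor \<Gamma>; \<delta> \<in> mor \<Gamma>; gdom \<Gamma> \<gamma> = gran \<Gamma> \<delta>\<rbrakk> \<Longrightarrow> gmult \<Gamma> \<gamma> \<delta> \<in> mor \<Gamma>"
    and gdom_gmult: "\<lbrakk>\<gamma> \<in> mor \<Gamma>; \<delta> \<in> mor \<Gamma>; gdom \<Gamma> \<gamma> = gran \<Gamma> \<delta>\<rbrakk>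
      \<Longrightarrow> gdom \<Gamma> (gmult \<Gamma> \<gamma> \<delta>) = gdom \<Gamma> \<delta>"
    and gran_gmult: "\<lbrakk>\<gamma> \<in> mor \<Gamma>; \<delta> \<in> mor \<Gamma>; gdom \<Gamma> \<gamma> = gran \<Gamma> \<delta>\<rbrakk>
      \<Longrightarrow> gran \<Gamma> (gmult \<Gamma> \<gamma> \<delta>) = gran \<Gamma> \<gamma>"
    and gmult_assoc: "\<lbrakk>\<gamma> \<in> mor \<Gamma>; \<delta> \<in> mor \<Gamma>; \<epsilon> \<in> mor \<Gamma>; gdom \<Gamma> \<gamma> = gran \<Gamma> \<delta>; gdom \<Gamma> \<delta> = gran \<Gamma> \<epsilon>\<rbrakk>
      \<Longrightarrow> gmult \<Gamma> (gmult \<Gamma> \<gamma> \<delta>) \<epsilon> = gmult \<Gamma> \<gamma> (gmult \<Gamma> \<delta> \<epsilon>)"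
    and gmult_gdom: "\<gamma> \<in> mor \<Gamma> \<Longrightarrow> gmult \<Gamma> \<gamma> (gdom \<Gamma> \<gamma>) = \<gamma>"
    and gran_gmult_id: "\<gamma> \<in> mor \<Gamma> \<Longrightarrow> gmult \<Gamma> (gran \<Gamma> \<gamma>) \<gamma> = \<gamma>"
    and ginv_closed: "\<gamma> \<in> mor \<Gamma> \<Longrightarrow> ginv \<Gamma> \<gamma> \<in> mor \<Gamma>"
    and gdom_ginv: "\<gamma> \<in> mor \<Gamma> \<Longrightarrow> gdom \<Gamma> (ginv \<Gamma> \<gamma>) = gran \<Gamma> \<gamma>"
    and gran_ginv: "\<gamma> \<in> mor \<Gamma> \<Longrightarrow> gran \<Gamma> (ginv \<Gamma> \<gamma>) = gdom \<Gamma> \<gamma>"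
    and ginv_gmult: "\<gamma> \<in> mor \<Gamma> \<Longrightarrow> gmult \<Gamma> (ginv \<Gamma> \<gamma>) \<gamma> = gdom \<Gamma> \<gamma>"
    and gmult_ginv: "\<gamma> \<in> mor \<Gamma> \<Longrightarrow> gmult \<Gamma> \<gamma> (ginv \<Gamma> \<gamma>) = gran \<Gamma> \<gamma>"

section \<open>Ideals, powers and nilpotency in rings without identity\<close>

definition additive_subgroup :: "'a::ab_group_add set \<Rightarrow> bool" where
  "additive_subgroup S \<longleftrightarrow> 0 \<in> S \<and> (\<forall>x\<in>S. \<forall>y\<in>S. x - y \<in> S)"

text \<open>Ideals are taken relative to a subring \<open>S\<close>, so that they make sense both in the whole
  ring (\<open>S = UNIV\<close>) and in the rings \<open>R e\<close>.\<close>

definition right_ideal :: "'a::ring set \<Rightarrow> 'a set \<Rightarrow> bool" where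
  "right_ideal S U \<longleftrightarrow> U \<subseteq> S \<and> additive_subgroup U \<and> (\<forall>u\<in>U. \<forall>a\<in>S. u * a \<in> U)"

definition left_ideal :: "'a::ring set \<Rightarrow> 'a set \<Rightarrow> bool" where
  "left_ideal S U \<longleftrightarrow> U \<subseteq> S \<and> additive_subgroup U \<and> (\<forall>u\<in>U. \<forall>a\<in>S. a * u \<in> U)"

definition two_sided_ideal :: "'a::ring set \<Rightarrow> 'a set \<Rightarrow> bool" where
  "two_sided_ideal S U \<longleftrightarrow> right_ideal S U \<and> left_ideal S U"

text \<open>The powers \<open>x\<^sup>n\<close> and \<open>S\<^sup>n\<close> below are the usual ones for \<open>n \<ge> 1\<close>; since there need not be
  an identity, no meaning is attached to \<open>n = 0\<close>.\<close>

definition ring_pow :: "'a::ring \<Rightarrow> nat \<Rightarrow> 'a" where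
  "ring_pow x n = (((*) x) ^^ (n - 1)) x"

definition nilpotent :: "'a::ring \<Rightarrow> bool" where
  "nilpotent x \<longleftrightarrow> (\<exists>n>0. ring_pow x n = 0)"

definition nil :: "'a::ring set \<Rightarrow> bool" where
  "nil U \<longleftrightarrow> (\<forall>x\<in>U. nilpotent x)"

definition subgroup_mult :: "'a::ring set \<Rightarrow> 'a set \<Rightarrow> 'a set" where
  "subgroup_mult S T = group_closure {s * t |s t. s \<in> S \<and> t \<in> T}"

definition subgroup_pow :: "'a::ring set \<Rightarrow> nat \<Rightarrow> 'a set" where
  "subgroup_pow S n = ((subgroup_mult S) ^^ (n - 1)) S"

definition is_identity_of :: "'a::ring \<Rightarrow> 'a set \<Rightarrow> bool" where
  "is_identity_of u S \<longleftrightarrow> u \<in> S \<and> (\<forall>x\<in>S. u * x = x \<and> x * u = x)"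

definition identity_of :: "'a::ring set \<Rightarrow> 'a" where
  "identity_of S = (THE u. is_identity_of u S)"

lemma identity_of_eq: "is_identity_of u S \<Longrightarrow> identity_of S = u"
  unfolding identity_of_def
  by (rule the_equality) (assumption, metis is_identity_of_def)

section \<open>Groupoid graded rings\<close>

definition internal_direct_sum :: "'i set \<Rightarrow> ('i \<Rightarrow> 'a::ab_group_add set) \<Rightarrow> 'a set \<Rightarrow> bool" where
  "internal_direct_sum I A U \<longleftrightarrow>
     additive_subgroup U \<and> (\<forall>i\<in>I. additive_subgroup (A i) \<and> A i \<subseteq> U) \<and>
     (\<forall>x\<in>U. \<exists>!f. (\<forall>i\<in>I. f i \<in> A i) \<and> (\<forall>i. i \<notin> I \<longrightarrow> f i = 0) \<and>
        finite {i. f i \<noteq> 0} \<and> x = (\<Sum>i\<in>{i. f i \<noteq> 0}. f i))"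

text \<open>The ring is the whole type \<open>'a\<close> of class \<^class>\<open>ring\<close> (associative, identity not
  required); \<open>R \<gamma>\<close> is the homogeneous component of degree \<open>\<gamma>\<close>, relevant only for
  \<open>\<gamma> \<in> mor \<Gamma>\<close>.\<close>

locale graded_ring = groupoid \<Gamma> for \<Gamma> :: "'g groupoid_struct" +
  fixes R :: "'g \<Rightarrow> 'a::ring set"
  assumes direct_sum: "internal_direct_sum (mor \<Gamma>) R UNIV"
    and graded_mult: "\<lbrakk>\<gamma> \<in> mor \<Gamma>; \<delta> \<in> mor \<Gamma>; gdom \<Gamma> \<gamma> = gran \<Gamma> \<delta>; a \<in> R \<gamma>; b \<in> R \<delta>\<rbrakk>
      \<Longrightarrow> a * b \<in> R (gmult \<Gamma> \<gamma> \<delta>)"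
    and graded_mult_zero: "\<lbrakk>\<gamma> \<in> mor \<Gamma>; \<delta> \<in> mor \<Gamma>; gdom \<Gamma> \<gamma> \<noteq> gran \<Gamma> \<delta>; a \<in> R \<gamma>; b \<in> R \<delta>\<rbrakk>
      \<Longrightarrow> a * b = 0"

locale object_unital_graded_ring = graded_ring \<Gamma> R
  for \<Gamma> :: "'g groupoid_struct" and R :: "'g \<Rightarrow> 'a::ring set" +
  assumes identity_exists: "e \<in> objs \<Gamma> \<Longrightarrow> \<exists>u. is_identity_of u (R e)"
    and identity_left: "\<lbrakk>\<gamma> \<in> mor \<Gamma>; a \<in> R \<gamma>\<rbrakk> \<Longrightarrow> identity_of (R (gran \<Gamma> \<gamma>)) * a = a"
    and identity_right: "\<lbrakk>\<gamma> \<in> mor \<Gamma>; a \<in> R \<gamma>\<rbrakk> \<Longrightarrow> a * identity_of (R (gdom \<Gamma> \<gamma>)) = a"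

definition homogeneous :: "'g groupoid_struct \<Rightarrow> ('g \<Rightarrow> 'a::ring set) \<Rightarrow> 'a set" where
  "homogeneous \<Gamma> R = (\<Union>\<gamma>\<in>mor \<Gamma>. R \<gamma>)"

definition graded :: "'g groupoid_struct \<Rightarrow> ('g \<Rightarrow> 'a::ring set) \<Rightarrow> 'a set \<Rightarrow> bool" where
  "graded \<Gamma> R U \<longleftrightarrow> internal_direct_sum (mor \<Gamma>) (\<lambda>\<gamma>. U \<inter> R \<gamma>) U"

definition graded_ideal :: "'g groupoid_struct \<Rightarrow> ('g \<Rightarrow> 'a::ring set) \<Rightarrow> 'a set \<Rightarrow> bool" where
  "graded_ideal \<Gamma> R U \<longleftrightarrow> two_sided_ideal UNIV U \<and> graded \<Gamma> R U"

definition graded_right_ideal :: "'g groupoid_struct \<Rightarrow> ('g \<Rightarrow> 'a::ring set) \<Rightarrow> 'a set \<Rightarrow> bool" where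
  "graded_right_ideal \<Gamma> R U \<longleftrightarrow> right_ideal UNIV U \<and> graded \<Gamma> R U"

definition graded_left_ideal :: "'g groupoid_struct \<Rightarrow> ('g \<Rightarrow> 'a::ring set) \<Rightarrow> 'a set \<Rightarrow> bool" where
  "graded_left_ideal \<Gamma> R U \<longleftrightarrow> left_ideal UNIV U \<and> graded \<Gamma> R U"

text \<open>\<open>(*) u ` U\<close> is \<open>{u * x | x. x \<in> U}\<close>; in particular \<open>(*) (identity_of (R e)) ` UNIV\<close> is
  the right ideal \<open>1\<^sub>e R\<close>.\<close>

definition right_artinian :: "'g groupoid_struct \<Rightarrow> ('g \<Rightarrow> 'a::ring set) \<Rightarrow> bool" where
  "right_artinian \<Gamma> R \<longleftrightarrow> (\<forall>e\<in>objs \<Gamma>. \<not> (\<exists>C :: nat \<Rightarrow> 'a set. \<forall>n.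
     graded_right_ideal \<Gamma> R (C n) \<and> C n \<subseteq> (*) (identity_of (R e)) ` UNIV \<and> C (Suc n) \<subset> C n))"

definition gr_maximal_right_ideal :: "'g groupoid_struct \<Rightarrow> ('g \<Rightarrow> 'a::ring set) \<Rightarrow> 'a set \<Rightarrow> bool" where
  "gr_maximal_right_ideal \<Gamma> R M \<longleftrightarrow> graded_right_ideal \<Gamma> R M \<and> M \<noteq> UNIV \<and>
     (\<forall>N. graded_right_ideal \<Gamma> R N \<and> N \<noteq> UNIV \<and> M \<subseteq> N \<longrightarrow> N = M)"

text \<open>If there is no gr-maximal graded right ideal (as for the zero ring), this intersection
  is the whole ring.\<close>

definition gr_rad :: "'g groupoid_struct \<Rightarrow> ('g \<Rightarrow> 'a::ring set) \<Rightarrow> 'a set" where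
  "gr_rad \<Gamma> R = \<Inter> {M. gr_maximal_right_ideal \<Gamma> R M}"

definition gr_nil :: "'g groupoid_struct \<Rightarrow> ('g \<Rightarrow> 'a::ring set) \<Rightarrow> 'a set \<Rightarrow> bool" where
  "gr_nil \<Gamma> R U \<longleftrightarrow> (\<forall>x \<in> U \<inter> homogeneous \<Gamma> R. nilpotent x)"

definition objs_nilpotent :: "'g groupoid_struct \<Rightarrow> ('g \<Rightarrow> 'a::ring set) \<Rightarrow> 'a set \<Rightarrow> bool" where
  "objs_nilpotent \<Gamma> R U \<longleftrightarrow>
     (\<forall>e\<in>objs \<Gamma>. \<exists>n>0. subgroup_pow ((*) (identity_of (R e)) ` U) n = {0})"

definition is_greatest :: "('a set \<Rightarrow> bool) \<Rightarrow> 'a set \<Rightarrow> bool" where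
  "is_greatest P X \<longleftrightarrow> P X \<and> (\<forall>U. P U \<longrightarrow> U \<subseteq> X)"

end

(*
  Let J = rad^gr(R).  A homogeneous element a of degree \<gamma> lies in J as soon as a b is nilpotent
  for all b of degree \<gamma>^-1: a gr-maximal M not containing a would give 1 = m + a b in the ring of
  degree r(\<gamma>), where 1 - a b is invertible.  As a b is nilpotent iff b a is, every one-sided graded
  ideal U all of whose U_e are nil is contained in J.  All parts thus reduce to the nilpotency of
  P = 1_e J.  By the chain condition B = P^n satisfies P B = B for some n.  If B were nonzero, take
  a graded right ideal I minimal subject to I B being nonzero, and a homogeneous x in I with x B
  nonzero; then x P B = x B, so x P = I contains x, and x = x p with p in J contradicts
  Nakayama's lemma.
*)

theory Submission
  imports Defs
begin

section \<open>Additive subgroups and products of subgroups\<close>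

lemma additive_subgroupI:
  "0 \<in> S \<Longrightarrow> (\<And>x y. x \<in> S \<Longrightarrow> y \<in> S \<Longrightarrow> x - y \<in> S) \<Longrightarrow> additive_subgroup S"
  by (simp add: additive_subgroup_def)

lemma additive_subgroup_zero: "additive_subgroup S \<Longrightarrow> 0 \<in> S"
  by (simp add: additive_subgroup_def)

lemma additive_subgroup_diff:
  "additive_subgroup S \<Longrightarrow> x \<in> S \<Longrightarrow> y \<in> S \<Longrightarrow> x - y \<in> S"
  by (simp add: additive_subgroup_def)

lemma additive_subgroup_add:
  assumes "additive_subgroup S" "x \<in> S" "y \<in> S"
  shows "x + y \<in> S"
proof -
  have "x - (0 - y) \<in> S"
    using assms by (intro additive_subgroup_diff) (auto intro: additive_subgroup_zero)
  then show ?thesis by simp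
qed

lemma additive_subgroup_sum:
  assumes "additive_subgroup S" "\<And>i. i \<in> I \<Longrightarrow> f i \<in> S"
  shows "sum f I \<in> S"
  using assms(2)
  by (induction I rule: infinite_finite_induct)
    (auto intro: additive_subgroup_zero additive_subgroup_add assms(1))

lemma additive_subgroup_group_closure: "additive_subgroup (group_closure S)"
  by (simp add: additive_subgroup_def group_closure.diff)

lemma group_closure_subset:
  assumes "S \<subseteq> T" "additive_subgroup T"
  shows "group_closure S \<subseteq> T"
proof
  show "x \<in> T" if "x \<in> group_closure S" for x
    using that
    by induction
      (use assms in \<open>auto intro: additive_subgroup_zero additive_subgroup_diff\<close>)
qed

lemma subgroup_multI: "s \<in> S \<Longrightarrow> t \<in> T \<Longrightarrow> s * t \<in> subgroup_mult S T"
  unfolding subgroup_mult_def by (rule group_closure.base) blast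

lemma subgroup_mult_subset:
  "additive_subgroup U \<Longrightarrow> (\<And>s t. s \<in> S \<Longrightarrow> t \<in> T \<Longrightarrow> s * t \<in> U) \<Longrightarrow> subgroup_mult S T \<subseteq> U"
  unfolding subgroup_mult_def by (rule group_closure_subset) auto

lemma additive_subgroup_subgroup_mult: "additive_subgroup (subgroup_mult S T)"
  unfolding subgroup_mult_def by (rule additive_subgroup_group_closure)

lemma subgroup_mult_mono: "S \<subseteq> S' \<Longrightarrow> T \<subseteq> T' \<Longrightarrow> subgroup_mult S T \<subseteq> subgroup_mult S' T'"
  by (rule subgroup_mult_subset[OF additive_subgroup_subgroup_mult]) (auto intro: subgroup_multI)

lemma subgroup_pow_mono:
  assumes "S \<subseteq> S'"
  shows "subgroup_pow S n \<subseteq> subgroup_pow S' n"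
proof -
  have "(subgroup_mult S ^^ k) S \<subseteq> (subgroup_mult S' ^^ k) S'" for k
    using assms by (induction k) (auto dest: subgroup_mult_mono[OF assms])
  then show ?thesis by (simp add: subgroup_pow_def)
qed

lemma zero_in_subgroup_pow:
  assumes "0 \<in> S"
  shows "0 \<in> subgroup_pow S n"
proof -
  have "0 \<in> (subgroup_mult S ^^ k) S" for k
    using assms by (cases k) (auto intro: additive_subgroup_zero additive_subgroup_subgroup_mult)
  then show ?thesis by (simp add: subgroup_pow_def)
qed

lemma ring_pow_in_subgroup_pow:
  assumes "x \<in> S"
  shows "ring_pow x n \<in> subgroup_pow S n"
proof -
  have "((*) x ^^ k) x \<in> (subgroup_mult S ^^ k) S" for k
    using assms by (induction k) (auto intro: subgroup_multI)
  then show ?thesis by (simp add: subgroup_pow_def ring_pow_def)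
qed

text \<open>Regrouping gives (a b)^(n+1) = a (b a)^n b. This carries nilpotency from b a, which lies
  in a given left ideal, to a b.\<close>

lemma nilpotent_mult_commute:
  fixes a b :: "'a::ring"
  assumes "nilpotent (b * a)"
  shows "nilpotent (a * b)"
proof -
  obtain n where n: "n > 0" "ring_pow (b * a) n = 0"
    using assms by (auto simp: nilpotent_def)
  have "((*) (a * b) ^^ Suc k) (a * b) = a * ((*) (b * a) ^^ k) (b * a) * b" for k
    by (induction k) (auto simp: mult.assoc)
  \<comment> \<open>The k-fold iterate is the power k + 1, so k = n - 1 turns the middle factor into
    (b a)^n.\<close>
  from this[of "n - 1"] n have "ring_pow (a * b) (Suc n) = 0"
    by (simp add: ring_pow_def)
  then show ?thesis unfolding nilpotent_def by blast
qed

section \<open>Homogeneous components\<close>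

context graded_ring
begin

definition decomposition :: "'a \<Rightarrow> ('g \<Rightarrow> 'a) \<Rightarrow> bool" where
  "decomposition x f \<longleftrightarrow> (\<forall>i\<in>mor \<Gamma>. f i \<in> R i) \<and> (\<forall>i. i \<notin> mor \<Gamma> \<longrightarrow> f i = 0) \<and>
     finite {i. f i \<noteq> 0} \<and> x = (\<Sum>i\<in>{i. f i \<noteq> 0}. f i)"

text \<open>Requiring 0 outside \<open>mor \<Gamma>\<close> makes the family unique as a function,
  so the description always denotes.\<close>

definition component :: "'g \<Rightarrow> 'a \<Rightarrow> 'a" where
  "component \<gamma> x = (THE f. decomposition x f) \<gamma>"

lemma additive_subgroup_R: "\<gamma> \<in> mor \<Gamma> \<Longrightarrow> additive_subgroup (R \<gamma>)"
  using direct_sum by (auto simp: internal_direct_sum_def)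

lemma decomposition_ex1: "\<exists>!f. decomposition x f"
  using direct_sum unfolding internal_direct_sum_def decomposition_def by blast

lemma decomposition_component: "decomposition x (\<lambda>\<gamma>. component \<gamma> x)"
  unfolding component_def using theI'[OF decomposition_ex1] by auto

lemma component_eqI: "decomposition x f \<Longrightarrow> component \<gamma> x = f \<gamma>"
  using decomposition_ex1 decomposition_component by metis

lemma component_in_R: "\<gamma> \<in> mor \<Gamma> \<Longrightarrow> component \<gamma> x \<in> R \<gamma>"
  using decomposition_component by (auto simp: decomposition_def)

lemma component_diff: "component \<gamma> (x - y) = component \<gamma> x - component \<gamma> y"
proof (rule component_eqI)
  let ?f = "\<lambda>i. component i x" and ?g = "\<lambda>i. component i y"
  have f: "decomposition x ?f" and g: "decomposition y ?g"
    by (rule decomposition_component)+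
  let ?I = "{i. ?f i \<noteq> 0} \<union> {i. ?g i \<noteq> 0}"
  have fin: "finite ?I" using f g by (simp add: decomposition_def)
  have sub: "{i. ?f i - ?g i \<noteq> 0} \<subseteq> ?I" by auto
  have "x = sum ?f ?I" "y = sum ?g ?I"
    using f g fin unfolding decomposition_def
    by (auto intro!: sum.mono_neutral_left elim: trans)
  then have "x - y = (\<Sum>i\<in>?I. ?f i - ?g i)"
    by (simp add: sum_subtractf)
  also have "\<dots> = (\<Sum>i\<in>{i. ?f i - ?g i \<noteq> 0}. ?f i - ?g i)"
    using fin by (intro sum.mono_neutral_right) auto
  finally show "decomposition (x - y) (\<lambda>i. ?f i - ?g i)"
    using f g finite_subset[OF sub fin]
    by (auto simp: decomposition_def intro: additive_subgroup_diff additive_subgroup_R)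
qed

lemma component_zero: "component \<gamma> 0 = 0"
  using component_diff[of \<gamma> 0 0] by simp

lemma component_add: "component \<gamma> (x + y) = component \<gamma> x + component \<gamma> y"
  using component_diff[of \<gamma> x "0 - y"] component_diff[of \<gamma> 0 y] by (simp add: component_zero)

lemma component_of_homogeneous:
  assumes "\<delta> \<in> mor \<Gamma>" "a \<in> R \<delta>"
  shows "component \<gamma> a = (if \<gamma> = \<delta> then a else 0)"
proof (rule component_eqI)
  have "{i. (if i = \<delta> then a else 0) \<noteq> 0} = (if a = 0 then {} else {\<delta>})" by auto
  then show "decomposition a (\<lambda>i. if i = \<delta> then a else 0)"
    using assms by (auto simp: decomposition_def intro: additive_subgroup_zero additive_subgroup_R)
qed

text \<open>Serves as an induction principle: with U the set of elements satisfying an additive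
  condition, it reduces that condition to homogeneous components.\<close>

lemma in_additive_subgroup_if_components:
  assumes "additive_subgroup U" "\<And>\<gamma>. \<gamma> \<in> mor \<Gamma> \<Longrightarrow> component \<gamma> x \<in> U"
  shows "x \<in> U"
proof -
  have "x = (\<Sum>i\<in>{i. component i x \<noteq> 0}. component i x)" "\<forall>i. i \<notin> mor \<Gamma> \<longrightarrow> component i x = 0"
    using decomposition_component by (auto simp: decomposition_def)
  moreover have "(\<Sum>i\<in>{i. component i x \<noteq> 0}. component i x) \<in> U"
    using assms additive_subgroup_zero by (intro additive_subgroup_sum) (use calculation(2) in auto)
  ultimately show ?thesis by metis
qed

lemma in_additive_subgroup_if_homogeneous:
  assumes "additive_subgroup U" "\<And>\<gamma> a. \<gamma> \<in> mor \<Gamma> \<Longrightarrow> a \<in> R \<gamma> \<Longrightarrow> a \<in> U"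
  shows "x \<in> U"
  using assms component_in_R by (blast intro: in_additive_subgroup_if_components)

text \<open>A decomposition inside U is also one in the ring, so uniqueness is inherited and only
  closure under components remains.\<close>

lemma graded_iff:
  "graded \<Gamma> R U \<longleftrightarrow> additive_subgroup U \<and> (\<forall>x\<in>U. \<forall>\<gamma>\<in>mor \<Gamma>. component \<gamma> x \<in> U)"
    (is "?L \<longleftrightarrow> ?R")
proof
  assume L: ?L
  show ?R
  proof (intro conjI ballI)
    show "additive_subgroup U" using L by (auto simp: graded_def internal_direct_sum_def)
    fix x \<gamma> assume "x \<in> U" and \<gamma>: "\<gamma> \<in> mor \<Gamma>"
    then obtain f where f: "\<forall>i\<in>mor \<Gamma>. f i \<in> U \<inter> R i" "\<forall>i. i \<notin> mor \<Gamma> \<longrightarrow> f i = 0"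
        "finite {i. f i \<noteq> 0}" "x = (\<Sum>i\<in>{i. f i \<noteq> 0}. f i)"
      using L unfolding graded_def internal_direct_sum_def by blast
    then have "decomposition x f" by (simp add: decomposition_def)
    then show "component \<gamma> x \<in> U" using component_eqI f(1) \<gamma> by auto
  qed
next
  assume R: ?R
  show ?L
    unfolding graded_def internal_direct_sum_def
  proof (intro conjI ballI)
    show "additive_subgroup U" using R by blast
    show "additive_subgroup (U \<inter> R i)" if "i \<in> mor \<Gamma>" for i
      using R additive_subgroup_R[OF that] by (simp add: additive_subgroup_def)
    fix x assume "x \<in> U"
    show "\<exists>!f. (\<forall>i\<in>mor \<Gamma>. f i \<in> U \<inter> R i) \<and> (\<forall>i. i \<notin> mor \<Gamma> \<longrightarrow> f i = 0) \<and>
        finite {i. f i \<noteq> 0} \<and> x = (\<Sum>i\<in>{i. f i \<noteq> 0}. f i)"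
    proof (rule ex1I)
      show "(\<forall>i\<in>mor \<Gamma>. component i x \<in> U \<inter> R i) \<and> (\<forall>i. i \<notin> mor \<Gamma> \<longrightarrow> component i x = 0) \<and>
        finite {i. component i x \<noteq> 0} \<and> x = (\<Sum>i\<in>{i. component i x \<noteq> 0}. component i x)"
        using decomposition_component[of x] R \<open>x \<in> U\<close> by (auto simp: decomposition_def)
      fix f assume "(\<forall>i\<in>mor \<Gamma>. f i \<in> U \<inter> R i) \<and> (\<forall>i. i \<notin> mor \<Gamma> \<longrightarrow> f i = 0) \<and>
        finite {i. f i \<noteq> 0} \<and> x = (\<Sum>i\<in>{i. f i \<noteq> 0}. f i)"
      then have "decomposition x f" by (simp add: decomposition_def)
      then show "f = (\<lambda>i. component i x)" using component_eqI by auto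
    qed
  qed simp
qed

text \<open>Left multiplication by \<gamma> is a bijection from the morphisms with range d(\<gamma>)
  to those with range r(\<gamma>), so a homogeneous left factor moves components without merging
  them.\<close>

lemma gmult_eq_iff:
  assumes "\<gamma> \<in> mor \<Gamma>" "\<delta> \<in> mor \<Gamma>" "\<epsilon> \<in> mor \<Gamma>" "gdom \<Gamma> \<gamma> = gran \<Gamma> \<delta>" "gran \<Gamma> \<epsilon> = gran \<Gamma> \<gamma>"
  shows "gmult \<Gamma> \<gamma> \<delta> = \<epsilon> \<longleftrightarrow> \<delta> = gmult \<Gamma> (ginv \<Gamma> \<gamma>) \<epsilon>"
  by (metis assms gdom_ginv ginv_closed ginv_gmult gmult_assoc gmult_ginv gran_ginv gran_gmult_id)

text \<open>Both sides are additive in x, which leaves x homogeneous of degree \<delta>. The product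
  then has degree \<gamma>\<delta>, or it vanishes when \<gamma>\<delta> is undefined.\<close>

lemma component_homogeneous_mult:
  assumes \<gamma>: "\<gamma> \<in> mor \<Gamma>" "a \<in> R \<gamma>" and \<epsilon>: "\<epsilon> \<in> mor \<Gamma>"
  shows "component \<epsilon> (a * x) =
    (if gran \<Gamma> \<epsilon> = gran \<Gamma> \<gamma> then a * component (gmult \<Gamma> (ginv \<Gamma> \<gamma>) \<epsilon>) x else 0)"
proof -
  let ?E = "\<lambda>x. component \<epsilon> (a * x) =
    (if gran \<Gamma> \<epsilon> = gran \<Gamma> \<gamma> then a * component (gmult \<Gamma> (ginv \<Gamma> \<gamma>) \<epsilon>) x else 0)"
  have "x \<in> {x. ?E x}"
  proof (rule in_additive_subgroup_if_homogeneous)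
    show "additive_subgroup {x. ?E x}"
      by (rule additive_subgroupI) (auto simp: component_zero component_diff right_diff_distrib)
    fix \<delta> b assume \<delta>: "\<delta> \<in> mor \<Gamma>" "b \<in> R \<delta>"
    show "b \<in> {x. ?E x}"
    proof (cases "gdom \<Gamma> \<gamma> = gran \<Gamma> \<delta>")
      case True
      then have "a * b \<in> R (gmult \<Gamma> \<gamma> \<delta>)" "gmult \<Gamma> \<gamma> \<delta> \<in> mor \<Gamma>"
        using graded_mult \<gamma> \<delta> gmult_closed by auto
      then show ?thesis
        using gmult_eq_iff[OF \<gamma>(1) \<delta>(1) \<epsilon> True] gran_gmult[OF \<gamma>(1) \<delta>(1) True] \<delta>
        by (auto simp: component_of_homogeneous)
    next
      case False
      have "gran \<Gamma> (gmult \<Gamma> (ginv \<Gamma> \<gamma>) \<epsilon>) = gdom \<Gamma> \<gamma>" if "gran \<Gamma> \<epsilon> = gran \<Gamma> \<gamma>"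
        using that \<gamma>(1) \<epsilon> by (simp add: gran_gmult ginv_closed gdom_ginv gran_ginv)
      then show ?thesis
        using False graded_mult_zero[OF \<gamma>(1) \<delta>(1) False \<gamma>(2) \<delta>(2)] \<delta>
        by (auto simp: component_of_homogeneous component_zero)
    qed
  qed
  then show ?thesis by simp
qed

text \<open>Degree r(\<gamma>) selects the part of x of degree \<gamma>^-1; this is how an equation
  1 = m + a r yields an element b of that degree.\<close>

lemma component_gran_mult:
  assumes "\<gamma> \<in> mor \<Gamma>" "a \<in> R \<gamma>"
  shows "component (gran \<Gamma> \<gamma>) (a * x) = a * component (ginv \<Gamma> \<gamma>) x"
proof -
  have o: "gran \<Gamma> \<gamma> \<in> mor \<Gamma>" "gran \<Gamma> (gran \<Gamma> \<gamma>) = gran \<Gamma> \<gamma>"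
    using gran_objs[OF assms(1)] by (auto simp: objs_def)
  have "gmult \<Gamma> (ginv \<Gamma> \<gamma>) (gran \<Gamma> \<gamma>) = ginv \<Gamma> \<gamma>"
    using gmult_gdom[OF ginv_closed[OF assms(1)]] by (simp add: gdom_ginv assms)
  then show ?thesis
    using component_homogeneous_mult[OF assms o(1)] o(2) by simp
qed

lemma component_mult_homogeneous_in:
  assumes U: "additive_subgroup U" and \<gamma>: "\<gamma> \<in> mor \<Gamma>" "a \<in> R \<gamma>" and \<epsilon>: "\<epsilon> \<in> mor \<Gamma>"
    and x: "\<And>\<delta>. \<delta> \<in> mor \<Gamma> \<Longrightarrow> a * component \<delta> x \<in> U"
  shows "component \<epsilon> (a * x) \<in> U"
  using component_homogeneous_mult[OF \<gamma> \<epsilon>, of x] x additive_subgroup_zero[OF U] \<gamma> \<epsilon>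
  by (simp add: gmult_closed ginv_closed gdom_ginv)

section \<open>Constructions of graded right ideals\<close>

lemma graded_rightI:
  assumes "additive_subgroup U" "\<And>u a. u \<in> U \<Longrightarrow> u * a \<in> U"
    "\<And>u \<gamma>. u \<in> U \<Longrightarrow> \<gamma> \<in> mor \<Gamma> \<Longrightarrow> component \<gamma> u \<in> U"
  shows "graded_right_ideal \<Gamma> R U"
  using assms by (auto simp: graded_right_ideal_def right_ideal_def graded_iff)

lemma graded_rightD:
  assumes "graded_right_ideal \<Gamma> R U"
  shows "additive_subgroup U" "u \<in> U \<Longrightarrow> u * a \<in> U"
    "u \<in> U \<Longrightarrow> \<gamma> \<in> mor \<Gamma> \<Longrightarrow> component \<gamma> u \<in> U"
  using assms by (auto simp: graded_right_ideal_def right_ideal_def graded_iff)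

lemma graded_right_ideal_image:
  assumes U: "graded_right_ideal \<Gamma> R U" and a: "\<gamma> \<in> mor \<Gamma>" "a \<in> R \<gamma>"
  shows "graded_right_ideal \<Gamma> R ((*) a ` U)"
proof (rule graded_rightI)
  show sub: "additive_subgroup ((*) a ` U)"
  proof (rule additive_subgroupI)
    show "0 \<in> (*) a ` U"
      using additive_subgroup_zero[OF graded_rightD(1)[OF U]] by (auto intro: rev_image_eqI)
    show "x - y \<in> (*) a ` U" if "x \<in> (*) a ` U" "y \<in> (*) a ` U" for x y
      using that additive_subgroup_diff[OF graded_rightD(1)[OF U]]
      by (auto simp flip: right_diff_distrib)
  qed
  show "u * b \<in> (*) a ` U" if "u \<in> (*) a ` U" for u b
    using that graded_rightD(2)[OF U] by (auto simp: mult.assoc)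
  show "component \<epsilon> u \<in> (*) a ` U" if "u \<in> (*) a ` U" "\<epsilon> \<in> mor \<Gamma>" for u \<epsilon>
    using that graded_rightD(3)[OF U]
    by (auto intro!: component_mult_homogeneous_in[OF sub a])
qed

text \<open>With U = 0 this is a right annihilator; with U gr-maximal it serves to show that the
  radical is also a left ideal.\<close>

lemma graded_right_ideal_vimage:
  assumes U: "graded_right_ideal \<Gamma> R U" and a: "\<gamma> \<in> mor \<Gamma>" "a \<in> R \<gamma>"
  shows "graded_right_ideal \<Gamma> R {x. a * x \<in> U}"
proof (rule graded_rightI)
  show "additive_subgroup {x. a * x \<in> U}"
    using graded_rightD(1)[OF U] by (auto simp: additive_subgroup_def right_diff_distrib)
  show "u * b \<in> {x. a * x \<in> U}" if "u \<in> {x. a * x \<in> U}" for u b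
    using that graded_rightD(2)[OF U] by (auto simp flip: mult.assoc)
  show "component \<delta> u \<in> {x. a * x \<in> U}" if u: "u \<in> {x. a * x \<in> U}" and \<delta>: "\<delta> \<in> mor \<Gamma>" for u \<delta>
  proof (cases "gdom \<Gamma> \<gamma> = gran \<Gamma> \<delta>")
    case True
    \<comment> \<open>In degree \<gamma>\<delta> the product a u has exactly a times the component
      of u in degree \<delta>.\<close>
    let ?\<epsilon> = "gmult \<Gamma> \<gamma> \<delta>"
    have \<epsilon>: "?\<epsilon> \<in> mor \<Gamma>" "gran \<Gamma> ?\<epsilon> = gran \<Gamma> \<gamma>"
      using True a \<delta> by (auto simp: gmult_closed gran_gmult)
    then have "component ?\<epsilon> (a * u) = a * component \<delta> u"
      using component_homogeneous_mult[OF a \<epsilon>(1), of u] gmult_eq_iff[OF a(1) \<delta> \<epsilon>(1) True \<epsilon>(2)]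
      by simp
    then show ?thesis using graded_rightD(3)[OF U _ \<epsilon>(1), of "a * u"] u by simp
  next
    case False
    then have "a * component \<delta> u = 0"
      using graded_mult_zero a \<delta> component_in_R by blast
    then show ?thesis using additive_subgroup_zero[OF graded_rightD(1)[OF U]] by simp
  qed
qed

lemma graded_right_ideal_zero: "graded_right_ideal \<Gamma> R {0}"
  by (rule graded_rightI) (auto simp: additive_subgroup_def component_zero)

lemma graded_right_ideal_UNIV: "graded_right_ideal \<Gamma> R UNIV"
  by (rule graded_rightI) (auto simp: additive_subgroup_def)

lemma graded_right_ideal_sum:
  assumes U: "graded_right_ideal \<Gamma> R U" and V: "graded_right_ideal \<Gamma> R V"
  shows "graded_right_ideal \<Gamma> R {u + v |u v. u \<in> U \<and> v \<in> V}" (is "graded_right_ideal _ _ ?S")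
proof (rule graded_rightI)
  show "additive_subgroup ?S"
  proof (rule additive_subgroupI)
    show "0 \<in> ?S"
      using additive_subgroup_zero[OF graded_rightD(1)[OF U]]
        additive_subgroup_zero[OF graded_rightD(1)[OF V]] by force
    show "x - y \<in> ?S" if xy: "x \<in> ?S" "y \<in> ?S" for x y
    proof -
      obtain u v u' v' where *: "u \<in> U" "v \<in> V" "u' \<in> U" "v' \<in> V" "x = u + v" "y = u' + v'"
        using xy by blast
      then have "x - y = (u - u') + (v - v')" by (simp add: algebra_simps)
      moreover have "u - u' \<in> U" "v - v' \<in> V"
        using * additive_subgroup_diff graded_rightD(1) U V by blast+
      ultimately show ?thesis by blast
    qed
  qed
  show "u * a \<in> ?S" if "u \<in> ?S" for u a
    using that graded_rightD(2)[OF U] graded_rightD(2)[OF V] by (force simp: distrib_right)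
  show "component \<gamma> u \<in> ?S" if "u \<in> ?S" "\<gamma> \<in> mor \<Gamma>" for u \<gamma>
    using that graded_rightD(3)[OF U] graded_rightD(3)[OF V] by (force simp: component_add)
qed

lemma graded_right_ideal_Inter:
  assumes "\<And>M. M \<in> \<M> \<Longrightarrow> graded_right_ideal \<Gamma> R M"
  shows "graded_right_ideal \<Gamma> R (\<Inter>\<M>)"
proof (rule graded_rightI)
  show "additive_subgroup (\<Inter>\<M>)"
    using graded_rightD(1)[OF assms] by (simp add: additive_subgroup_def)
qed (use assms graded_rightD in blast)+

lemma graded_right_ideal_Union_chain:
  assumes "\<C> \<noteq> {}" "\<And>M. M \<in> \<C> \<Longrightarrow> graded_right_ideal \<Gamma> R M"
    and chain: "\<And>M N. M \<in> \<C> \<Longrightarrow> N \<in> \<C> \<Longrightarrow> M \<subseteq> N \<or> N \<subseteq> M"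
  shows "graded_right_ideal \<Gamma> R (\<Union>\<C>)"
proof (rule graded_rightI)
  show "additive_subgroup (\<Union>\<C>)"
  proof (rule additive_subgroupI)
    show "0 \<in> \<Union>\<C>" using assms(1,2) graded_rightD(1) additive_subgroup_zero by blast
    show "x - y \<in> \<Union>\<C>" if "x \<in> \<Union>\<C>" "y \<in> \<Union>\<C>" for x y
    proof -
      obtain M N where MN: "M \<in> \<C>" "N \<in> \<C>" "x \<in> M" "y \<in> N" using \<open>x \<in> \<Union>\<C>\<close> \<open>y \<in> \<Union>\<C>\<close> by blast
      have "\<exists>K\<in>\<C>. x \<in> K \<and> y \<in> K" using chain[OF MN(1,2)] MN by blast
      then show ?thesis using assms(2) graded_rightD(1) additive_subgroup_diff by blast
    qed
  qed
qed (use assms(2) graded_rightD in blast)+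

text \<open>Each closure property defines an additive subgroup, so generators s t suffice. For
  components, s is split further, because the product formula needs a homogeneous left
  factor.\<close>

lemma graded_right_ideal_subgroup_mult:
  assumes S: "graded_right_ideal \<Gamma> R S" and T: "graded_right_ideal \<Gamma> R T"
  shows "graded_right_ideal \<Gamma> R (subgroup_mult S T)"
proof (rule graded_rightI)
  let ?P = "subgroup_mult S T"
  show sub: "additive_subgroup ?P" by (rule additive_subgroup_subgroup_mult)
  show "u * a \<in> ?P" if "u \<in> ?P" for u a
  proof -
    have "?P \<subseteq> {u. u * a \<in> ?P}"
    proof (rule subgroup_mult_subset)
      show "additive_subgroup {u. u * a \<in> ?P}"
        using sub by (auto simp: additive_subgroup_def left_diff_distrib)
      show "s * t \<in> {u. u * a \<in> ?P}" if "s \<in> S" "t \<in> T" for s t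
        using that graded_rightD(2)[OF T] by (auto simp: mult.assoc intro: subgroup_multI)
    qed
    then show ?thesis using that by blast
  qed
  show "component \<epsilon> u \<in> ?P" if "u \<in> ?P" and \<epsilon>: "\<epsilon> \<in> mor \<Gamma>" for u \<epsilon>
  proof -
    have "?P \<subseteq> {u. component \<epsilon> u \<in> ?P}"
    proof (rule subgroup_mult_subset)
      show "additive_subgroup {u. component \<epsilon> u \<in> ?P}"
        using sub by (auto simp: additive_subgroup_def component_diff component_zero)
      fix s t assume st: "s \<in> S" "t \<in> T"
      have "s \<in> {s. component \<epsilon> (s * t) \<in> ?P}"
      proof (rule in_additive_subgroup_if_components)
        show "additive_subgroup {s. component \<epsilon> (s * t) \<in> ?P}"
          using sub by (auto simp: additive_subgroup_def component_diff component_zero left_diff_distrib)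
        fix \<gamma> assume \<gamma>: "\<gamma> \<in> mor \<Gamma>"
        have "component \<gamma> s \<in> S" using graded_rightD(3)[OF S] st \<gamma> by blast
        then show "component \<gamma> s \<in> {s. component \<epsilon> (s * t) \<in> ?P}"
          using graded_rightD(3)[OF T] st
          by (auto intro!: component_mult_homogeneous_in[OF sub \<gamma> component_in_R[OF \<gamma>] \<epsilon>] subgroup_multI)
      qed
      then show "s * t \<in> {u. component \<epsilon> u \<in> ?P}" by simp
    qed
    then show ?thesis using that by blast
  qed
qed

end


section \<open>The graded radical\<close>

context object_unital_graded_ring
begin

abbreviation idm :: "'g \<Rightarrow> 'a" where
  "idm e \<equiv> identity_of (R e)"

lemma objs_mor: "e \<in> objs \<Gamma> \<Longrightarrow> e \<in> mor \<Gamma>"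
  by (simp add: objs_def)

lemma idm_in_R: "e \<in> objs \<Gamma> \<Longrightarrow> idm e \<in> R e"
  using identity_exists identity_of_eq by (metis is_identity_of_def)

text \<open>A homogeneous a equals 1_{r(\<gamma>)} a, so the local identities play the role of a
  global one.\<close>

lemma graded_right_ideal_eq_UNIV:
  assumes U: "graded_right_ideal \<Gamma> R U" and "\<And>e. e \<in> objs \<Gamma> \<Longrightarrow> idm e \<in> U"
  shows "U = UNIV"
proof -
  have "x \<in> U" for x
  proof (rule in_additive_subgroup_if_homogeneous[OF graded_rightD(1)[OF U]])
    fix \<gamma> a assume "\<gamma> \<in> mor \<Gamma>" "a \<in> R \<gamma>"
    then show "a \<in> U"
      using identity_left graded_rightD(2)[OF U] assms(2) gran_objs by metis
  qed
  then show ?thesis by blast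
qed

lemma in_principal: "\<gamma> \<in> mor \<Gamma> \<Longrightarrow> a \<in> R \<gamma> \<Longrightarrow> a \<in> range ((*) a)"
  using identity_right by (metis rangeI)

section \<open>Gr-maximal right ideals and two-sidedness of the radical\<close>

lemma gr_maximal_rightD:
  assumes M: "gr_maximal_right_ideal \<Gamma> R M"
  shows "graded_right_ideal \<Gamma> R M" "M \<noteq> UNIV"
    and "graded_right_ideal \<Gamma> R N \<Longrightarrow> M \<subseteq> N \<Longrightarrow> N = M \<or> N = UNIV"
  using assms unfolding gr_maximal_right_ideal_def by blast+

text \<open>M + aR is graded because a is homogeneous, and it contains a = a 1_{d(\<gamma>)}, so
  maximality makes it the whole ring.\<close>

lemma gr_maximal_add_principal:
  assumes M: "gr_maximal_right_ideal \<Gamma> R M" and a: "\<gamma> \<in> mor \<Gamma>" "a \<in> R \<gamma>" and "a \<notin> M"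
  obtains m r where "m \<in> M" "x = m + a * r"
proof -
  let ?N = "{u + v |u v. u \<in> M \<and> v \<in> range ((*) a)}"
  have N: "graded_right_ideal \<Gamma> R ?N"
    using gr_maximal_rightD(1)[OF M] graded_right_ideal_image[OF graded_right_ideal_UNIV a]
    by (rule graded_right_ideal_sum)
  have 0: "0 \<in> M" "0 \<in> range ((*) a)"
    using gr_maximal_rightD(1)[OF M] graded_rightD(1) additive_subgroup_zero
    by blast (metis mult_zero_right rangeI)
  have "M \<subseteq> ?N"
  proof
    show "m \<in> ?N" if "m \<in> M" for m using that 0(2) by (force intro: exI[of _ m])
  qed
  moreover have "a \<in> ?N" using in_principal[OF a] 0(1) by (force intro: exI[of _ 0])
  ultimately have "?N = UNIV" using gr_maximal_rightD(3)[OF M N] \<open>a \<notin> M\<close> by blast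
  then have "x \<in> ?N" by blast
  then show thesis using that by blast
qed

lemma graded_right_ideal_gr_rad: "graded_right_ideal \<Gamma> R (gr_rad \<Gamma> R)"
  unfolding gr_rad_def by (rule graded_right_ideal_Inter) (auto dest: gr_maximal_rightD)

text \<open>Left multiplication by r embeds R/K into the gr-simple module R/M, where K is the
  preimage of M; hence R/K, being nonzero, is gr-simple too.\<close>

lemma gr_maximal_vimage:
  assumes M: "gr_maximal_right_ideal \<Gamma> R M" and r: "\<delta> \<in> mor \<Gamma>" "r \<in> R \<delta>"
    and proper: "{x. r * x \<in> M} \<noteq> UNIV"
  shows "gr_maximal_right_ideal \<Gamma> R {x. r * x \<in> M}" (is "gr_maximal_right_ideal \<Gamma> R ?K")
  unfolding gr_maximal_right_ideal_def
proof (intro conjI allI impI proper)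
  note gM = gr_maximal_rightD(1)[OF M]
  show "graded_right_ideal \<Gamma> R ?K" by (rule graded_right_ideal_vimage[OF gM r])
  fix N assume N: "graded_right_ideal \<Gamma> R N \<and> N \<noteq> UNIV \<and> ?K \<subseteq> N"
  show "N = ?K"
  proof (rule ccontr)
    assume "N \<noteq> ?K"
    then obtain y where y: "y \<in> N" "r * y \<notin> M" using N by blast
    \<comment> \<open>Adding a principal ideal to M requires a homogeneous generator, so y is
      replaced by a component z with r z still outside M.\<close>
    have "\<exists>\<gamma>\<in>mor \<Gamma>. r * component \<gamma> y \<notin> M"
      using in_additive_subgroup_if_components[of ?K y]
        graded_rightD(1)[OF graded_right_ideal_vimage[OF gM r]] y(2) by blast
    then obtain \<gamma> where \<gamma>: "\<gamma> \<in> mor \<Gamma>" "r * component \<gamma> y \<notin> M" by blast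
    define z where "z = component \<gamma> y"
    have z: "z \<in> R \<gamma>" "z \<in> N" "r * z \<notin> M"
      using component_in_R graded_rightD(3) N y(1) \<gamma> by (auto simp: z_def)
    \<comment> \<open>Being outside M, r z is nonzero, so the degrees compose and r z is
      homogeneous.\<close>
    have comp: "gdom \<Gamma> \<delta> = gran \<Gamma> \<gamma>"
      using graded_mult_zero[OF r(1) \<gamma>(1) _ r(2) z(1)] z(3) graded_rightD(1)[OF gM]
        additive_subgroup_zero by force
    have rz: "gmult \<Gamma> \<delta> \<gamma> \<in> mor \<Gamma>" "r * z \<in> R (gmult \<Gamma> \<delta> \<gamma>)"
      using gmult_closed graded_mult comp r \<gamma>(1) z(1) by auto
    have "x \<in> N" for x
    proof -
      \<comment> \<open>As M + (r z)R is the whole ring, r x is congruent to r z t modulo M, so x -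
        z t falls into the preimage of M.\<close>
      obtain m t where mt: "m \<in> M" "r * x = m + r * z * t"
        using gr_maximal_add_principal[OF M rz z(3)] by blast
      then have "r * (x - z * t) = m" by (simp add: algebra_simps)
      then have "x - z * t \<in> ?K" using mt(1) by blast
      then have "x - z * t \<in> N" "z * t \<in> N" using N z(2) graded_rightD(2) by blast+
      then have "(x - z * t) + z * t \<in> N"
        using N graded_rightD(1) additive_subgroup_add by blast
      then show "x \<in> N" by simp
    qed
    then show False using N by blast
  qed
qed

lemma gr_rad_left:
  assumes "u \<in> gr_rad \<Gamma> R"
  shows "r * u \<in> gr_rad \<Gamma> R"
  unfolding gr_rad_def
proof
  fix M assume "M \<in> {M. gr_maximal_right_ideal \<Gamma> R M}"
  then have M: "gr_maximal_right_ideal \<Gamma> R M" by simp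
  have "r \<in> {r. r * u \<in> M}"
  proof (rule in_additive_subgroup_if_homogeneous)
    show "additive_subgroup {r. r * u \<in> M}"
      using graded_rightD(1)[OF gr_maximal_rightD(1)[OF M]]
      by (auto simp: additive_subgroup_def left_diff_distrib)
    fix \<delta> a assume a: "\<delta> \<in> mor \<Gamma>" "a \<in> R \<delta>"
    \<comment> \<open>This preimage of M is either the whole ring or gr-maximal; in both cases it
      contains u.\<close>
    then have "u \<in> {x. a * x \<in> M}"
      using gr_maximal_vimage[OF M a] assms unfolding gr_rad_def by blast
    then show "a \<in> {r. r * u \<in> M}" by simp
  qed
  then show "r * u \<in> M" by simp
qed

lemma graded_ideal_gr_rad: "graded_ideal \<Gamma> R (gr_rad \<Gamma> R)"
  using graded_right_ideal_gr_rad gr_rad_left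
  by (auto simp: graded_ideal_def two_sided_ideal_def graded_right_ideal_def left_ideal_def graded_iff)

text \<open>The product a b has degree r(\<gamma>), so membership in the radical is tested by
  nilpotency inside the rings R e alone.\<close>

lemma in_gr_rad_if_nilpotent:
  assumes a: "\<gamma> \<in> mor \<Gamma>" "a \<in> R \<gamma>" and nil: "\<And>b. b \<in> R (ginv \<Gamma> \<gamma>) \<Longrightarrow> nilpotent (a * b)"
  shows "a \<in> gr_rad \<Gamma> R"
proof (rule ccontr)
  assume "a \<notin> gr_rad \<Gamma> R"
  then obtain M where M: "gr_maximal_right_ideal \<Gamma> R M" "a \<notin> M"
    by (auto simp: gr_rad_def)
  note gM = gr_maximal_rightD(1)[OF M(1)]
  define e where "e = gran \<Gamma> \<gamma>"
  have e: "e \<in> objs \<Gamma>" "e \<in> mor \<Gamma>" using gran_objs objs_mor a by (auto simp: e_def)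
  have ea: "idm e * a = a" using identity_left a by (simp add: e_def)
  obtain m r where m: "m \<in> M" "idm e = m + a * r"
    using gr_maximal_add_principal[OF M(1) a M(2)] by blast
  \<comment> \<open>Only this component of r contributes to degree e of a r, and its degree is the
    one covered by \<open>nil\<close>.\<close>
  define b where "b = component (ginv \<Gamma> \<gamma>) r"
  have "component e (idm e) = component e m + component e (a * r)"
    by (subst m(2)) (rule component_add)
  moreover have "component e (a * r) = a * b"
    using component_gran_mult[OF a] by (simp add: e_def b_def)
  ultimately have "idm e - a * b = component e m"
    using component_of_homogeneous[OF e(2) idm_in_R[OF e(1)], of e] by simp
  then have 1: "idm e - a * b \<in> M"
    using graded_rightD(3)[OF gM m(1) e(2)] by simp
  \<comment> \<open>No inverse of 1_e - a b is formed: every power of a b is congruent to 1_e modulo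
    M. With p the power k + 1, 1_e - a b p = (1_e - a b) p + (1_e - p).\<close>
  have pow: "idm e - ((*) (a * b) ^^ k) (a * b) \<in> M" for k
  proof (induction k)
    case (Suc k)
    let ?p = "((*) (a * b) ^^ k) (a * b)"
    have "idm e * ?p = ?p" using ea by (cases k) (auto simp flip: mult.assoc)
    then have "idm e - a * b * ?p = (idm e - a * b) * ?p + (idm e - ?p)"
      by (simp add: left_diff_distrib)
    moreover have "(idm e - a * b) * ?p + (idm e - ?p) \<in> M"
      using Suc graded_rightD(2)[OF gM 1] additive_subgroup_add[OF graded_rightD(1)[OF gM]] by blast
    ultimately show ?case by (simp only: funpow.simps o_apply)
  qed (use 1 in simp)
  have "b \<in> R (ginv \<Gamma> \<gamma>)" using component_in_R ginv_closed a by (simp add: b_def)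
  then obtain n where "n > 0" "ring_pow (a * b) n = 0" using nil by (auto simp: nilpotent_def)
  then have "idm e \<in> M" using pow[of "n - 1"] by (simp add: ring_pow_def)
  then have "a \<in> M" using graded_rightD(2)[OF gM, of "idm e" a] ea by simp
  then show False using M(2) by blast
qed

text \<open>Graded Nakayama lemma: if \<open>x \<noteq> 0\<close>, a gr-maximal right ideal above the right annihilator
  of \<open>x\<close>, which contains \<open>1 - c\<close>, would contain \<open>c\<close> and hence an identity that it must avoid.\<close>

lemma eq_zero_if_fixed_by_gr_rad:
  assumes x: "\<gamma> \<in> mor \<Gamma>" "x \<in> R \<gamma>" and c: "c \<in> gr_rad \<Gamma> R" and xc: "x * c = x"
  shows "x = 0"
proof (rule ccontr)
  assume "x \<noteq> 0"
  define d where "d = gdom \<Gamma> \<gamma>"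
  have d: "d \<in> objs \<Gamma>" using gdom_objs x by (simp add: d_def)
  have xd: "x * idm d = x" using identity_right x by (simp add: d_def)
  define K where "K = {z. x * z \<in> {0}}"
  have K: "graded_right_ideal \<Gamma> R K"
    unfolding K_def by (rule graded_right_ideal_vimage[OF graded_right_ideal_zero x])
  \<comment> \<open>Avoiding one fixed element passes to unions of chains, whereas properness need
    not do so without a global identity.\<close>
  define \<A> where "\<A> = {N. graded_right_ideal \<Gamma> R N \<and> K \<subseteq> N \<and> idm d \<notin> N}"
  have "K \<in> \<A>" using K xd \<open>x \<noteq> 0\<close> by (simp add: \<A>_def K_def)
  have "\<exists>N\<in>\<A>. \<forall>X\<in>\<A>. N \<subseteq> X \<longrightarrow> X = N"
  proof (rule subset_Zorn_nonempty)
    show "\<A> \<noteq> {}" using \<open>K \<in> \<A>\<close> by blast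
    fix \<C> assume \<C>: "\<C> \<noteq> {}" "subset.chain \<A> \<C>"
    then have sub: "\<C> \<subseteq> \<A>" by (auto simp: subset_chain_def)
    have "graded_right_ideal \<Gamma> R (\<Union>\<C>)"
    proof (rule graded_right_ideal_Union_chain[OF \<C>(1)])
      show "graded_right_ideal \<Gamma> R M" if "M \<in> \<C>" for M using that sub by (auto simp: \<A>_def)
      show "M \<subseteq> N \<or> N \<subseteq> M" if "M \<in> \<C>" "N \<in> \<C>" for M N
        using that \<C>(2) by (auto simp: subset_chain_def)
    qed
    then show "\<Union>\<C> \<in> \<A>" using \<C>(1) sub by (auto simp: \<A>_def)
  qed
  then obtain N where N: "N \<in> \<A>" "\<And>X. X \<in> \<A> \<Longrightarrow> N \<subseteq> X \<Longrightarrow> X = N" by blast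
  then have gN: "graded_right_ideal \<Gamma> R N" "K \<subseteq> N" "idm d \<notin> N" by (auto simp: \<A>_def)
  have "gr_maximal_right_ideal \<Gamma> R N"
    unfolding gr_maximal_right_ideal_def
  proof (intro conjI allI impI)
    fix N' assume N': "graded_right_ideal \<Gamma> R N' \<and> N' \<noteq> UNIV \<and> N \<subseteq> N'"
    show "N' = N"
    proof (cases "idm d \<in> N'")
      case True
      \<comment> \<open>For e different from d, x 1_e = 0 places 1_e in K; so a larger ideal
        containing 1_d contains all local identities.\<close>
      have "idm e \<in> N'" if e: "e \<in> objs \<Gamma>" for e
      proof (cases "e = d")
        case False
        then have "x * idm e = 0"
          using graded_mult_zero[OF x(1) objs_mor[OF e] _ x(2) idm_in_R[OF e]] e
          by (auto simp: d_def objs_def)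
        then show ?thesis using gN(2) N' by (auto simp: K_def)
      qed (use True in simp)
      then show ?thesis using graded_right_ideal_eq_UNIV N' by blast
    next
      case False
      then show ?thesis using N(2)[of N'] N' gN(2) by (auto simp: \<A>_def)
    qed
  qed (use gN in auto)
  then have "c \<in> N" using c by (auto simp: gr_rad_def)
  moreover have "idm d - c \<in> N"
    using gN(2) xd xc by (auto simp: K_def right_diff_distrib)
  ultimately have "(idm d - c) + c \<in> N"
    using additive_subgroup_add[OF graded_rightD(1)[OF gN(1)]] by blast
  then show False using gN(3) by simp
qed

section \<open>Nilpotency of the graded radical\<close>

text \<open>The chain condition makes strict inclusion well-founded on the graded right ideals
  inside 1_e R. Any L' below L lies in 1_e R automatically.\<close>

lemma right_artinian_minimal:
  assumes "right_artinian \<Gamma> R" "e \<in> objs \<Gamma>"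
    and "graded_right_ideal \<Gamma> R I" "I \<subseteq> range ((*) (idm e))" "P I"
  obtains L where "graded_right_ideal \<Gamma> R L" "L \<subseteq> range ((*) (idm e))" "P L"
    and "\<And>L'. graded_right_ideal \<Gamma> R L' \<Longrightarrow> L' \<subseteq> L \<Longrightarrow> P L' \<Longrightarrow> L' = L"
proof -
  define Q where "Q L \<longleftrightarrow> graded_right_ideal \<Gamma> R L \<and> L \<subseteq> range ((*) (idm e))" for L
  have wf: "wf {(A, B). Q A \<and> Q B \<and> A \<subset> B}"
    unfolding wf_iff_no_infinite_down_chain
  proof
    assume "\<exists>C. \<forall>i. (C (Suc i), C i) \<in> {(A, B). Q A \<and> Q B \<and> A \<subset> B}"
    then obtain C where "\<forall>i. (C (Suc i), C i) \<in> {(A, B). Q A \<and> Q B \<and> A \<subset> B}" ..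
    then have C: "\<forall>n. graded_right_ideal \<Gamma> R (C n) \<and> C n \<subseteq> range ((*) (idm e)) \<and> C (Suc n) \<subset> C n"
      by (simp add: Q_def)
    then show False using assms(1,2) unfolding right_artinian_def by blast
  qed
  have I: "I \<in> {L. Q L \<and> P L}" using assms by (simp add: Q_def)
  show thesis
  proof (rule wfE_min[OF wf I])
    fix L assume "L \<in> {L. Q L \<and> P L}"
      and "\<And>L'. (L', L) \<in> {(A, B). Q A \<and> Q B \<and> A \<subset> B} \<Longrightarrow> L' \<notin> {L. Q L \<and> P L}"
    then have L: "Q L" "P L" "\<And>L'. Q L' \<Longrightarrow> L' \<subset> L \<Longrightarrow> \<not> P L'" by simp_all
    show thesis
    proof (rule that)
      show "L' = L" if "graded_right_ideal \<Gamma> R L'" "L' \<subseteq> L" "P L'" for L'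
      proof (rule ccontr)
        assume "L' \<noteq> L"
        moreover have "Q L'" using that L(1) by (auto simp: Q_def)
        ultimately show False using L(3)[of L'] that by blast
      qed
    qed (use L in \<open>simp_all add: Q_def\<close>)
  qed
qed

lemma objs_nilpotent_gr_rad:
  assumes art: "right_artinian \<Gamma> R"
  shows "objs_nilpotent \<Gamma> R (gr_rad \<Gamma> R)"
  unfolding objs_nilpotent_def
proof
  fix e assume e: "e \<in> objs \<Gamma>"
  define P where "P = (*) (idm e) ` gr_rad \<Gamma> R"
  \<comment> \<open>\<open>Q n\<close> is the power P^(n+1), since the iteration starts at P
    itself.\<close>
  define Q where "Q n = (subgroup_mult P ^^ n) P" for n
  have QS: "Q (Suc n) = subgroup_mult P (Q n)" for n by (simp add: Q_def)
  have gP: "graded_right_ideal \<Gamma> R P"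
    unfolding P_def
    by (rule graded_right_ideal_image[OF graded_right_ideal_gr_rad objs_mor[OF e] idm_in_R[OF e]])
  have PJ: "P \<subseteq> gr_rad \<Gamma> R" using gr_rad_left by (auto simp: P_def)
  have Pe: "P \<subseteq> range ((*) (idm e))" by (auto simp: P_def)
  have gQ: "graded_right_ideal \<Gamma> R (Q n)" for n
    by (induction n) (auto simp: Q_def intro: gP graded_right_ideal_subgroup_mult)
  have dec: "Q (Suc n) \<subseteq> Q n" for n
  proof (induction n)
    case 0
    show ?case
      using subgroup_mult_subset[OF graded_rightD(1)[OF gP]] graded_rightD(2)[OF gP]
      by (simp add: Q_def)
  next
    case (Suc n)
    then show ?case using subgroup_mult_mono[OF order_refl] QS by metis
  qed
  have Qe: "Q n \<subseteq> range ((*) (idm e))" for n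
  proof (induction n)
    case 0
    show ?case using Pe by (simp add: Q_def)
  next
    case (Suc n)
    then show ?case using dec[of n] by blast
  qed
  have "\<exists>n. Q (Suc n) = Q n"
  proof (rule ccontr)
    assume "\<nexists>n. Q (Suc n) = Q n"
    then have "\<forall>n. graded_right_ideal \<Gamma> R (Q n) \<and> Q n \<subseteq> range ((*) (idm e)) \<and> Q (Suc n) \<subset> Q n"
      using gQ Qe dec by blast
    then show False using art e unfolding right_artinian_def by blast
  qed
  then obtain n where n: "subgroup_mult P (Q n) = Q n" using QS by auto
  define B where "B = Q n"
  have B0: "0 \<in> B" unfolding B_def by (intro additive_subgroup_zero graded_rightD(1) gQ)
  \<comment> \<open>As P B = B, an element y annihilates B once it annihilates every product p
    b.\<close>
  have ann: "y * b = 0" if "b \<in> B" "\<And>p b. p \<in> P \<Longrightarrow> b \<in> B \<Longrightarrow> y * (p * b) = 0" for y b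
  proof -
    have "subgroup_mult P B \<subseteq> {b. y * b = 0}"
      using that(2)
      by (intro subgroup_mult_subset) (auto simp: additive_subgroup_def right_diff_distrib)
    then show ?thesis using n that(1) by (auto simp: B_def)
  qed
  have "B = {0}"
  proof (rule ccontr)
    assume "B \<noteq> {0}"
    have "\<exists>p\<in>P. \<exists>b\<in>B. p * b \<noteq> 0"
    proof (rule ccontr)
      assume "\<not> (\<exists>p\<in>P. \<exists>b\<in>B. p * b \<noteq> 0)"
      then have "subgroup_mult P B \<subseteq> {0}"
        by (intro subgroup_mult_subset) (auto simp: additive_subgroup_def)
      then show False using n B0 \<open>B \<noteq> {0}\<close> by (auto simp: B_def)
    qed
    from right_artinian_minimal[OF art e gP Pe, of "\<lambda>I. \<exists>p\<in>I. \<exists>b\<in>B. p * b \<noteq> 0", OF this]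
    obtain I where I: "graded_right_ideal \<Gamma> R I" "I \<subseteq> range ((*) (idm e))" "\<exists>p\<in>I. \<exists>b\<in>B. p * b \<noteq> 0"
        "\<And>I'. graded_right_ideal \<Gamma> R I' \<Longrightarrow> I' \<subseteq> I \<Longrightarrow> \<exists>p\<in>I'. \<exists>b\<in>B. p * b \<noteq> 0 \<Longrightarrow> I' = I"
      by blast
    obtain y b where y: "y \<in> I" "b \<in> B" "y * b \<noteq> 0" using I(3) by blast
    \<comment> \<open>The elements annihilating b form an additive subgroup, so some component of y
      is not among them. Choosing it homogeneous makes x P graded.\<close>
    have "\<exists>\<gamma>\<in>mor \<Gamma>. component \<gamma> y * b \<noteq> 0"
      using in_additive_subgroup_if_components[of "{y. y * b = 0}" y] y(3)
      by (auto simp: additive_subgroup_def left_diff_distrib)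
    then obtain \<gamma> where \<gamma>: "\<gamma> \<in> mor \<Gamma>" "component \<gamma> y * b \<noteq> 0" by blast
    define x where "x = component \<gamma> y"
    have x: "x \<in> I" "x \<in> R \<gamma>" "x * b \<noteq> 0"
      using \<gamma> y graded_rightD(3)[OF I(1)] component_in_R by (auto simp: x_def)
    have "(*) x ` P = I"
    proof (rule I(4))
      show "graded_right_ideal \<Gamma> R ((*) x ` P)"
        by (rule graded_right_ideal_image[OF gP \<gamma>(1) x(2)])
      show "(*) x ` P \<subseteq> I" using graded_rightD(2)[OF I(1) x(1)] by blast
      \<comment> \<open>If x P annihilated B, then \<open>ann\<close> would give x b = 0.\<close>
      show "\<exists>p\<in>(*) x ` P. \<exists>b\<in>B. p * b \<noteq> 0"
        using ann[OF y(2), of x] x(3) by (auto simp: mult.assoc)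
    qed
    then obtain p where "p \<in> P" "x * p = x" using x(1) by auto
    then have "x = 0" using eq_zero_if_fixed_by_gr_rad[OF \<gamma>(1) x(2)] PJ by blast
    then show False using x(3) by simp
  qed
  \<comment> \<open>B is \<open>Q n\<close>, hence the exponent n + 1.\<close>
  then have "subgroup_pow P (Suc n) = {0}" by (simp add: B_def Q_def subgroup_pow_def)
  then show "\<exists>n>0. subgroup_pow ((*) (idm e) ` gr_rad \<Gamma> R) n = {0}" unfolding P_def by blast
qed

section \<open>Comparison of nilpotency conditions\<close>

text \<open>Monotonicity of powers gives one half of the equality with {0}; 0 in U gives the other
  half, also for the first power, which is the set itself.\<close>

lemma objs_nilpotent_mono:
  assumes "objs_nilpotent \<Gamma> R V" "U \<subseteq> V" "0 \<in> U"
  shows "objs_nilpotent \<Gamma> R U"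
  unfolding objs_nilpotent_def
proof
  fix e assume "e \<in> objs \<Gamma>"
  then obtain n where n: "n > 0" "subgroup_pow ((*) (idm e) ` V) n = {0}"
    using assms(1) by (auto simp: objs_nilpotent_def)
  have "subgroup_pow ((*) (idm e) ` U) n \<subseteq> {0}"
    using subgroup_pow_mono[OF image_mono[OF assms(2)], of "(*) (idm e)" n] n by simp
  moreover have "0 \<in> subgroup_pow ((*) (idm e) ` U) n"
    using assms(3) by (intro zero_in_subgroup_pow) (metis image_eqI mult_zero_right)
  ultimately show "\<exists>n>0. subgroup_pow ((*) (idm e) ` U) n = {0}" using n(1) by blast
qed

text \<open>A homogeneous x of degree \<gamma> equals 1_{r(\<gamma>)} x, so its n-th power lies in
  (1_{r(\<gamma>)} U)^n.\<close>

lemma gr_nil_if_objs_nilpotent: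
  assumes "objs_nilpotent \<Gamma> R U"
  shows "gr_nil \<Gamma> R U"
  unfolding gr_nil_def
proof
  fix x assume "x \<in> U \<inter> homogeneous \<Gamma> R"
  then obtain \<gamma> where x: "x \<in> U" "\<gamma> \<in> mor \<Gamma>" "x \<in> R \<gamma>" by (auto simp: homogeneous_def)
  let ?S = "(*) (idm (gran \<Gamma> \<gamma>)) ` U"
  obtain n where "n > 0" "subgroup_pow ?S n = {0}"
    using assms gran_objs[OF x(2)] by (auto simp: objs_nilpotent_def)
  moreover have "x \<in> ?S" using identity_left[OF x(2,3)] x(1) by force
  ultimately show "nilpotent x"
    using ring_pow_in_subgroup_pow[of x ?S n] unfolding nilpotent_def by auto
qed

lemma nil_if_gr_nil: "gr_nil \<Gamma> R U \<Longrightarrow> e \<in> objs \<Gamma> \<Longrightarrow> nil (U \<inter> R e)"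
  by (auto simp: gr_nil_def nil_def homogeneous_def objs_def)

text \<open>For a in U of degree \<gamma> and b of degree \<gamma>^-1, a right ideal contains a b
  and a left ideal contains b a. Both products have identity degrees, where elements of U are
  nilpotent by assumption.\<close>

lemma subset_gr_rad:
  assumes U: "graded_right_ideal \<Gamma> R U \<or> graded_left_ideal \<Gamma> R U"
    and nil: "\<And>e. e \<in> objs \<Gamma> \<Longrightarrow> nil (U \<inter> R e)"
  shows "U \<subseteq> gr_rad \<Gamma> R"
proof
  fix x assume x: "x \<in> U"
  show "x \<in> gr_rad \<Gamma> R"
  proof (rule in_additive_subgroup_if_components)
    show "additive_subgroup (gr_rad \<Gamma> R)" by (rule graded_rightD(1)[OF graded_right_ideal_gr_rad])
    fix \<gamma> assume \<gamma>: "\<gamma> \<in> mor \<Gamma>"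
    let ?a = "component \<gamma> x"
    have a: "?a \<in> R \<gamma>" "?a \<in> U"
      using component_in_R[OF \<gamma>] U x \<gamma>
      by (auto simp: graded_right_ideal_def graded_left_ideal_def graded_iff)
    show "?a \<in> gr_rad \<Gamma> R"
    proof (rule in_gr_rad_if_nilpotent[OF \<gamma> a(1)])
      fix b assume b: "b \<in> R (ginv \<Gamma> \<gamma>)"
      have "?a * b \<in> R (gran \<Gamma> \<gamma>)"
        using graded_mult[OF \<gamma> ginv_closed[OF \<gamma>] _ a(1) b] \<gamma> by (simp add: gran_ginv gmult_ginv)
      moreover have "b * ?a \<in> R (gdom \<Gamma> \<gamma>)"
        using graded_mult[OF ginv_closed[OF \<gamma>] \<gamma> _ b a(1)] \<gamma> by (simp add: gdom_ginv ginv_gmult)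
      moreover have "?a * b \<in> U \<or> b * ?a \<in> U"
        using U a(2)
        by (auto simp: graded_right_ideal_def graded_left_ideal_def right_ideal_def left_ideal_def)
      ultimately have "nilpotent (?a * b) \<or> nilpotent (b * ?a)"
        using nil gran_objs[OF \<gamma>] gdom_objs[OF \<gamma>] unfolding nil_def by blast
      then show "nilpotent (?a * b)" using nilpotent_mult_commute by blast
    qed
  qed
qed

end

theorem theorem4p2:
  fixes \<Gamma> :: "'g groupoid_struct" and R :: "'g \<Rightarrow> 'a::ring set"
  assumes "object_unital_graded_ring \<Gamma> R"
    and "right_artinian \<Gamma> R"
  shows "(is_greatest (\<lambda>U. graded_ideal \<Gamma> R U \<and> objs_nilpotent \<Gamma> R U) (gr_rad \<Gamma> R) \<and>
          is_greatest (\<lambda>U. graded_right_ideal \<Gamma> R U \<and> objs_nilpotent \<Gamma> R U) (gr_rad \<Gamma> R) \<and>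
          is_greatest (\<lambda>U. graded_left_ideal \<Gamma> R U \<and> objs_nilpotent \<Gamma> R U) (gr_rad \<Gamma> R)) \<and>
         (is_greatest (\<lambda>U. graded_ideal \<Gamma> R U \<and> gr_nil \<Gamma> R U) (gr_rad \<Gamma> R) \<and>
          is_greatest (\<lambda>U. graded_right_ideal \<Gamma> R U \<and> gr_nil \<Gamma> R U) (gr_rad \<Gamma> R) \<and>
          is_greatest (\<lambda>U. graded_left_ideal \<Gamma> R U \<and> gr_nil \<Gamma> R U) (gr_rad \<Gamma> R)) \<and>
         ((\<forall>U. graded_ideal \<Gamma> R U \<and>
               (\<forall>e\<in>objs \<Gamma>. two_sided_ideal (R e) (U \<inter> R e) \<and> nil (U \<inter> R e)) \<longrightarrow>
               objs_nilpotent \<Gamma> R U) \<and>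
          (\<forall>U. graded_right_ideal \<Gamma> R U \<and>
               (\<forall>e\<in>objs \<Gamma>. right_ideal (R e) (U \<inter> R e) \<and> nil (U \<inter> R e)) \<longrightarrow>
               objs_nilpotent \<Gamma> R U) \<and>
          (\<forall>U. graded_left_ideal \<Gamma> R U \<and>
               (\<forall>e\<in>objs \<Gamma>. left_ideal (R e) (U \<inter> R e) \<and> nil (U \<inter> R e)) \<longrightarrow>
               objs_nilpotent \<Gamma> R U)) \<and>
         ((\<forall>U. graded_ideal \<Gamma> R U \<and> gr_nil \<Gamma> R U \<longrightarrow> objs_nilpotent \<Gamma> R U) \<and>
          (\<forall>U. graded_right_ideal \<Gamma> R U \<and> gr_nil \<Gamma> R U \<longrightarrow> objs_nilpotent \<Gamma> R U) \<and>
          (\<forall>U. graded_left_ideal \<Gamma> R U \<and> gr_nil \<Gamma> R U \<longrightarrow> objs_nilpotent \<Gamma> R U))"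
proof -
  interpret object_unital_graded_ring \<Gamma> R by fact
  let ?J = "gr_rad \<Gamma> R"
  \<comment> \<open>Two-sided claims become instances of the one-sided ones, which are proved for
    right and left ideals at once.\<close>
  have two_sided: "graded_ideal \<Gamma> R U \<longleftrightarrow> graded_right_ideal \<Gamma> R U \<and> graded_left_ideal \<Gamma> R U" for U
    by (auto simp: graded_ideal_def graded_right_ideal_def graded_left_ideal_def two_sided_ideal_def)
  have zero: "0 \<in> U" if "graded_right_ideal \<Gamma> R U \<or> graded_left_ideal \<Gamma> R U" for U
    using that by (auto simp: graded_right_ideal_def graded_left_ideal_def graded_iff
        additive_subgroup_def)
  have J: "graded_right_ideal \<Gamma> R ?J" "graded_left_ideal \<Gamma> R ?J"
    using graded_ideal_gr_rad two_sided by auto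
  note Jnilp = objs_nilpotent_gr_rad[OF assms(2)]
  note Jnil = gr_nil_if_objs_nilpotent[OF Jnilp]
  have sub: "U \<subseteq> ?J"
    if "graded_right_ideal \<Gamma> R U \<or> graded_left_ideal \<Gamma> R U" "gr_nil \<Gamma> R U" for U
    using that subset_gr_rad nil_if_gr_nil by blast
  have sub': "U \<subseteq> ?J"
    if "graded_right_ideal \<Gamma> R U \<or> graded_left_ideal \<Gamma> R U" "objs_nilpotent \<Gamma> R U" for U
    using that by (intro sub gr_nil_if_objs_nilpotent)
  \<comment> \<open>U lies in the radical, and the condition on 1_e U is inherited from there, so
    left ideals require no separate argument.\<close>
  have nilp: "objs_nilpotent \<Gamma> R U"
    if "graded_right_ideal \<Gamma> R U \<or> graded_left_ideal \<Gamma> R U" "\<forall>e\<in>objs \<Gamma>. nil (U \<inter> R e)" for U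
    using that by (intro objs_nilpotent_mono[OF Jnilp] subset_gr_rad zero) simp_all
  have gr_nil_nilp: "objs_nilpotent \<Gamma> R U"
    if "graded_right_ideal \<Gamma> R U \<or> graded_left_ideal \<Gamma> R U" "gr_nil \<Gamma> R U" for U
    using that nilp nil_if_gr_nil by blast
  show ?thesis
    unfolding is_greatest_def two_sided
    by (intro conjI allI impI)
      (simp_all add: J Jnilp Jnil sub sub' nilp gr_nil_nilp)
qed

end
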